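(* $$\sum_{r=1}^\infty \frac{H_{r,3}^2}{r(r+1)}=-\frac{10\pi^2}{3}\,\zeta(5)+35\,\zeta(7) .$$
   Context: For a positive integer $N$, $H_{N,m}=\sum_{r=1}^N \frac{1}{r^m}$ is the generalized harmonic number of order $m$; $H_{r,3}^2$ denotes $(H_{r,3})^2$. $\zeta(m)=\sum_{r=1}^\infty r^{-m}$ is the Riemann zeta function. *)

theory Defs
  imports "HOL-Analysis.Analysis"
begin

definition gen_harm :: "nat \<Rightarrow> nat \<Rightarrow> real" where
  "gen_harm N m = (\<Sum>r=1..N. 1 / real r ^ m)"

(* Riemann zeta at integer arguments; meaningful only for m \<ge> 2, where the series
   converges. The index is shifted so that the sum starts at r = 1. *)
definition zeta :: "nat \<Rightarrow> real" where
  "zeta m = (\<Sum>r. 1 / real (Suc r) ^ m)"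

end

theory Submission
  imports Defs
begin

text \<open>
  Summation by parts turns the series into \<open>2 \<Sum> H\<^bsub>r,3\<^esub> / r\<^sup>4 - \<zeta>(7) = 2 \<zeta>(4,3) + \<zeta>(7)\<close>,
  where \<open>\<zeta>(a,b) = \<Sum>\<^bsub>n>m\<^esub> n\<^bsup>-a\<^esup> m\<^bsup>-b\<^esup>\<close>. The five double zeta values of weight 7 are
  determined by five linear relations. Two come from splitting the products \<open>\<zeta>(2) \<zeta>(5)\<close> and
  \<open>\<zeta>(3) \<zeta>(4)\<close> along the diagonal; two from reducing the same products by partial
  fractions, which acts on the Tornheim sums \<open>T(a,b,c) = \<Sum> 1 / (m\<^sup>a n\<^sup>b (m+n)\<^sup>c)\<close> as
  \<open>T(a,b,c) = T(a-1,b,c+1) + T(a,b-1,c+1)\<close> and ends at \<open>T(0,b,c) = \<zeta>(c,b)\<close>; and the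
  fifth from evaluating \<open>T(5,1,1)\<close> both in this way and through
  \<open>\<Sum>\<^sub>n 1 / (n (m+n)) = H\<^bsub>m,1\<^esub> / m\<close>. Solving gives \<open>\<zeta>(4,3) = 17 \<zeta>(7) - 10 \<zeta>(2) \<zeta>(5)\<close>.
\<close>

definition tornheim_term :: "nat \<Rightarrow> nat \<Rightarrow> nat \<Rightarrow> nat \<times> nat \<Rightarrow> real" where
  "tornheim_term a b c = (\<lambda>(m, n). 1 / (real m ^ a * real n ^ b * real (m + n) ^ c))"

text \<open>\<open>infsum\<close> is 0 on families that are not summable, so convergence is recorded
  in a separate predicate and passed along with each value.\<close>

definition tornheim_summable :: "nat \<Rightarrow> nat \<Rightarrow> nat \<Rightarrow> bool" where
  "tornheim_summable a b c \<longleftrightarrow> tornheim_term a b c summable_on {1..} \<times> {1..}"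

definition tornheim :: "nat \<Rightarrow> nat \<Rightarrow> nat \<Rightarrow> real" where
  "tornheim a b c = infsum (tornheim_term a b c) ({1..} \<times> {1..})"

definition double_zeta_term :: "nat \<Rightarrow> nat \<Rightarrow> nat \<times> nat \<Rightarrow> real" where
  "double_zeta_term a b = (\<lambda>(n, m). 1 / (real n ^ a * real m ^ b))"

definition double_zeta :: "nat \<Rightarrow> nat \<Rightarrow> real" where
  "double_zeta a b = infsum (double_zeta_term a b) (SIGMA n:{1..}. {1..<n})"

definition double_zeta_summable :: "nat \<Rightarrow> nat \<Rightarrow> bool" where
  "double_zeta_summable a b \<longleftrightarrow> double_zeta_term a b summable_on (SIGMA n:{1..}. {1..<n})"

lemma tornheim_term_nonneg: "tornheim_term a b c p \<ge> 0"
  by (simp add: tornheim_term_def split: prod.split)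

section \<open>Zeta values as unordered sums over positive integers\<close>

lemma has_sum_Suc_iff:
  "((\<lambda>n. f (Suc n)) has_sum S) UNIV \<longleftrightarrow> (f has_sum S) {1..}"
  by (rule has_sum_reindex_bij_witness[where i = "\<lambda>n. n - 1" and j = Suc]) auto

lemma summable_zeta:
  assumes "s \<ge> 2"
  shows "summable (\<lambda>n. 1 / real (Suc n) ^ s)"
  using inverse_power_summable[OF assms, where 'a = real]
  by (subst summable_Suc_iff[of "\<lambda>n. 1 / real n ^ s"]) (simp add: inverse_eq_divide)

lemma zeta_has_sum:
  assumes "s \<ge> 2"
  shows "((\<lambda>n. 1 / real n ^ s) has_sum zeta s) {1..}"
proof -
  have "(\<lambda>n. 1 / real (Suc n) ^ s) sums zeta s"
    unfolding zeta_def using summable_zeta[OF assms] by (rule summable_sums)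
  then have "((\<lambda>n. 1 / real (Suc n) ^ s) has_sum zeta s) UNIV"
    by (rule sums_nonneg_imp_has_sum) simp
  then show ?thesis
    using has_sum_Suc_iff[of "\<lambda>n. 1 / real n ^ s"] by blast
qed

lemma zeta_2: "zeta 2 = pi\<^sup>2 / 6"
  using inverse_squares_sums unfolding zeta_def by (simp add: sums_iff add.commute)

subsection \<open>Tornheim sums\<close>

text \<open>Multiply by \<open>(m + n) / (m + n)\<close> and split the numerator: one summand
  cancels a factor \<open>m\<close>, the other a factor \<open>n\<close>.\<close>

lemma tornheim_term_partial_fractions:
  assumes "p \<in> {1..} \<times> {1..}" "a > 0" "b > 0"
  shows "tornheim_term a b c p
           = tornheim_term (a - 1) b (c + 1) p + tornheim_term a (b - 1) (c + 1) p"
proof -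
  obtain a' b' where ab: "a = Suc a'" "b = Suc b'"
    using assms by (meson gr0_implies_Suc)
  obtain m n where p: "p = (m, n)" "m \<ge> 1" "n \<ge> 1"
    using assms by auto
  have ne: "real m ^ k \<noteq> 0" "real n ^ k \<noteq> 0" "(real m + real n) ^ k \<noteq> 0" for k
    using p by (auto simp: add_pos_pos)
  have "real m \<noteq> 0" "real n \<noteq> 0" "real m + real n \<noteq> 0" using p by auto
  then show ?thesis
    unfolding tornheim_term_def p ab using ne by (simp add: divide_simps)
qed

text \<open>Both parts of the split term are nonnegative, so each is dominated by the whole and
  inherits its summability; the sum may then be split.\<close>

lemma tornheim_rec:
  assumes "tornheim_summable a b c" "a > 0" "b > 0"
  shows "tornheim_summable (a - 1) b (c + 1)" (is ?A)
    and "tornheim_summable a (b - 1) (c + 1)" (is ?B)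
    and "tornheim a b c = tornheim (a - 1) b (c + 1) + tornheim a (b - 1) (c + 1)"
proof -
  note pf = tornheim_term_partial_fractions[OF _ assms(2,3)]
  show A: ?A unfolding tornheim_summable_def
    by (rule summable_on_comparison_test[OF assms(1)[unfolded tornheim_summable_def]])
       (simp_all only: pf le_add_same_cancel1 tornheim_term_nonneg)
  show B: ?B unfolding tornheim_summable_def
    by (rule summable_on_comparison_test[OF assms(1)[unfolded tornheim_summable_def]])
       (simp_all only: pf le_add_same_cancel2 tornheim_term_nonneg)
  have "tornheim a b c = (\<Sum>\<^sub>\<infinity>p\<in>{1..} \<times> {1..}.
          tornheim_term (a - 1) b (c + 1) p + tornheim_term a (b - 1) (c + 1) p)"
    unfolding tornheim_def by (rule infsum_cong) (rule pf)
  then show "tornheim a b c = tornheim (a - 1) b (c + 1) + tornheim a (b - 1) (c + 1)"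
    using A B by (simp only: infsum_add tornheim_def tornheim_summable_def)
qed

lemma tornheim_commute: "tornheim a b c = tornheim b a c"
  unfolding tornheim_def
  by (rule infsum_reindex_bij_witness[where i = prod.swap and j = prod.swap])
     (auto simp: tornheim_term_def mult_ac add_ac)

text \<open>Taking \<open>m + n\<close> as a new index makes it the larger one of a pair, the
  smaller being \<open>n\<close>; hence the exchange of \<open>b\<close> and
  \<open>c\<close>.\<close>

lemma tornheim_0_left: "tornheim 0 b c = double_zeta c b"
  unfolding tornheim_def double_zeta_def
  by (rule infsum_reindex_bij_witness[where i = "\<lambda>(n, m). (n - m, m)" and j = "\<lambda>(m, n). (m + n, n)"])
     (auto simp: tornheim_term_def double_zeta_term_def mult_ac)

lemma tornheim_summable_0_left:
  assumes "tornheim_summable 0 b c"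
  shows "double_zeta_summable c b"
  using assms unfolding tornheim_summable_def double_zeta_summable_def
  by (subst (asm) summable_on_reindex_bij_witness[where i = "\<lambda>(n, m). (n - m, m)"
        and j = "\<lambda>(m, n). (m + n, n)" and T = "SIGMA n:{1..}. {1..<n}"
        and h = "double_zeta_term c b"])
     (auto simp: tornheim_term_def double_zeta_term_def mult_ac)

lemma tornheim_0_middle: "tornheim a 0 c = double_zeta c a"
  by (subst tornheim_commute) (rule tornheim_0_left)

text \<open>With \<open>c = 0\<close> the term is a product, so the iterated sums are explicit;
  nonnegativity turns them into summability over the quadrant.\<close>

lemma zeta_mult_has_sum:
  assumes "a \<ge> 2" "b \<ge> 2"
  shows "(tornheim_term a b 0 has_sum zeta a * zeta b) ({1..} \<times> {1..})"
proof (rule has_sum_SigmaI)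
  show in_n: "((\<lambda>n. tornheim_term a b 0 (m, n)) has_sum 1 / real m ^ a * zeta b) {1..}" for m
    using has_sum_cmult_right[OF zeta_has_sum[OF assms(2)], of "1 / real m ^ a"]
    by (simp add: tornheim_term_def)
  show in_m: "((\<lambda>m. 1 / real m ^ a * zeta b) has_sum zeta a * zeta b) {1..}"
    by (rule has_sum_cmult_left[OF zeta_has_sum[OF assms(1)]])
  show "tornheim_term a b 0 summable_on {1..} \<times> {1..}"
    by (rule summable_on_SigmaI[OF in_n has_sum_imp_summable[OF in_m] tornheim_term_nonneg])
qed

lemma tornheim_0_right:
  assumes "a \<ge> 2" "b \<ge> 2"
  shows "tornheim_summable a b 0" "tornheim a b 0 = zeta a * zeta b"
  using zeta_mult_has_sum[OF assms]
  by (auto simp: tornheim_summable_def tornheim_def has_sum_imp_summable infsumI)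

subsection \<open>Double zeta values\<close>

text \<open>In the quadrant, \<open>U\<close> (first index larger) and its mirror image
  \<open>L\<close> give the two double zeta values, and the diagonal \<open>D\<close> gives
  \<open>zeta (a + b)\<close>.\<close>

lemma zeta_mult_stuffle:
  assumes "a \<ge> 2" "b \<ge> 2"
  shows "double_zeta_summable a b"
    and "zeta a * zeta b = double_zeta a b + double_zeta b a + zeta (a + b)"
proof -
  define f where "f = tornheim_term a b 0"
  define U where "U = (SIGMA n:{1::nat..}. {1..<n})"
  define L where "L = prod.swap ` U"
  define D where "D = (\<lambda>n::nat. (n, n)) ` {1..}"
  have UN: "{1..} \<times> {1..} = U \<union> L \<union> D"
  proof (intro set_eqI)
    fix p :: "nat \<times> nat"
    obtain n m where "p = (n, m)" by (cases p)
    then show "p \<in> {1..} \<times> {1..} \<longleftrightarrow> p \<in> U \<union> L \<union> D"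
      by (cases n m rule: linorder_cases) (auto simp: U_def L_def D_def image_iff)
  qed
  have f: "(f has_sum zeta a * zeta b) (U \<union> L \<union> D)"
    unfolding f_def UN[symmetric] by (rule zeta_mult_has_sum[OF assms])
  have sm: "f summable_on U" "f summable_on L"
    using has_sum_imp_summable[OF f] by (auto intro: summable_on_subset)
  have fU: "f = double_zeta_term a b"
    by (auto simp: f_def tornheim_term_def double_zeta_term_def)
  show "double_zeta_summable a b"
    unfolding double_zeta_summable_def using sm(1) by (simp only: fU U_def)
  have iU: "infsum f U = double_zeta a b"
    by (simp only: fU U_def double_zeta_def)
  have iL: "infsum f L = double_zeta b a"
    unfolding L_def double_zeta_def U_def
    by (subst infsum_reindex) (auto intro!: infsum_cong simp: fU double_zeta_term_def mult_ac)
  have D: "(f has_sum zeta (a + b)) D"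
    unfolding D_def
    by (subst has_sum_reindex)
       (use zeta_has_sum[of "a + b"] assms in
         \<open>auto simp: inj_on_def fU double_zeta_term_def o_def power_add\<close>)
  have "(f has_sum infsum f U + infsum f L + zeta (a + b)) (U \<union> L \<union> D)"
    by (intro has_sum_Un_disjoint has_sum_infsum sm D) (auto simp: U_def L_def D_def)
  from has_sum_unique[OF f this] show
    "zeta a * zeta b = double_zeta a b + double_zeta b a + zeta (a + b)"
    by (simp only: iL iU)
qed

section \<open>Sums of harmonic numbers\<close>

lemma gen_harm_Suc: "gen_harm (Suc n) m = gen_harm n m + 1 / real (Suc n) ^ m"
  by (simp add: gen_harm_def)

text \<open>The inner sum over \<open>m < n\<close> yields \<open>gen_harm (n - 1) b\<close>; the
  diagonal terms \<open>1 / n ^ (a + b)\<close> complete it to \<open>gen_harm n b\<close>. Assuming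
  summability instead of \<open>b \<ge> 2\<close> admits the pair (6,1).\<close>

lemma gen_harm_div_has_sum:
  assumes "double_zeta_summable a b" "a \<ge> 2"
  shows "((\<lambda>n. gen_harm n b / real n ^ a) has_sum double_zeta a b + zeta (a + b)) {1..}"
proof -
  have inner: "((\<lambda>m. double_zeta_term a b (n, m)) has_sum gen_harm (n - 1) b / real n ^ a) {1..<n}"
    if "n \<in> {1..}" for n
  proof -
    have "{1..<n} = {1..n - 1}" using that by auto
    then have "(\<Sum>m\<in>{1..<n}. double_zeta_term a b (n, m)) = gen_harm (n - 1) b / real n ^ a"
      by (simp add: double_zeta_term_def gen_harm_def sum_divide_distrib mult.commute)
    then show ?thesis
      using has_sum_finite[of "{1..<n}" "\<lambda>m. double_zeta_term a b (n, m)"] by simp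
  qed
  have "(double_zeta_term a b has_sum double_zeta a b) (SIGMA n:{1..}. {1..<n})"
    unfolding double_zeta_def
    by (rule has_sum_infsum[OF assms(1)[unfolded double_zeta_summable_def]])
  from has_sum_SigmaD[OF this inner]
  have "((\<lambda>n. gen_harm (n - 1) b / real n ^ a) has_sum double_zeta a b) {1..}" .
  from has_sum_add[OF this zeta_has_sum[of "a + b"]] assms(2)
  have "((\<lambda>n. gen_harm (n - 1) b / real n ^ a + 1 / real n ^ (a + b))
          has_sum double_zeta a b + zeta (a + b)) {1..}" by simp
  moreover have "gen_harm (n - 1) b / real n ^ a + 1 / real n ^ (a + b) = gen_harm n b / real n ^ a"
    if "n \<in> {1..}" for n
  proof -
    have "gen_harm n b = gen_harm (n - 1) b + 1 / real n ^ b"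
      using that gen_harm_Suc[of "n - 1" b] by simp
    then show ?thesis
      by (simp add: power_add add_divide_distrib mult.commute)
  qed
  ultimately show ?thesis
    by (subst (asm) has_sum_cong) auto
qed

text \<open>Raising \<open>m\<close> by one adds a telescoping series of value
  \<open>1 / (m + 1)\<close>.\<close>

lemma harmonic_telescope_sums:
  "(\<lambda>n. 1 / real (Suc n) - 1 / real (Suc n + m)) sums gen_harm m 1"
proof (induction m)
  case 0
  then show ?case by (simp add: gen_harm_def)
next
  case (Suc m)
  have "(\<lambda>n. 1 / real (Suc n + m)) \<longlonglongrightarrow> 0"
    using LIMSEQ_ignore_initial_segment[OF lim_inverse_n', of "Suc m"] by (simp add: add_ac)
  from telescope_sums'[OF this]
  have "(\<lambda>n. 1 / real (Suc n + m) - 1 / real (Suc n + Suc m)) sums (1 / real (Suc m))"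
    by simp
  from sums_add[OF Suc.IH this] show ?case
    by (simp add: gen_harm_Suc)
qed

lemma harmonic_has_sum:
  assumes "m \<ge> 1"
  shows "((\<lambda>n. 1 / (real n * real (m + n))) has_sum gen_harm m 1 / real m) {1..}"
proof -
  have "(\<lambda>n. (1 / real (Suc n) - 1 / real (Suc n + m)) / real m) sums (gen_harm m 1 / real m)"
    by (rule sums_divide[OF harmonic_telescope_sums])
  moreover have "(1 / real (Suc n) - 1 / real (Suc n + m)) / real m
                   = 1 / (real (Suc n) * real (m + Suc n))" for n
    using assms by (simp add: divide_simps)
  ultimately have "(\<lambda>n. 1 / (real (Suc n) * real (m + Suc n))) sums (gen_harm m 1 / real m)"
    by simp
  then have "((\<lambda>n. 1 / (real (Suc n) * real (m + Suc n))) has_sum (gen_harm m 1 / real m)) UNIV"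
    by (rule sums_nonneg_imp_has_sum) simp
  then show ?thesis
    using has_sum_Suc_iff[of "\<lambda>n. 1 / (real n * real (m + n))"] by blast
qed

text \<open>For fixed \<open>m\<close>, the inner sum over \<open>n\<close> is
  \<open>1 / m ^ a\<close> times \<open>gen_harm m 1 / m\<close>.\<close>

lemma tornheim_1_1_has_sum:
  assumes "tornheim_summable a 1 1"
  shows "((\<lambda>n. gen_harm n 1 / real n ^ Suc a) has_sum tornheim a 1 1) {1..}"
proof (rule has_sum_SigmaD)
  show "(tornheim_term a 1 1 has_sum tornheim a 1 1) ({1..} \<times> {1..})"
    unfolding tornheim_def by (rule has_sum_infsum[OF assms[unfolded tornheim_summable_def]])
  show "((\<lambda>n. tornheim_term a 1 1 (m, n)) has_sum gen_harm m 1 / real m ^ Suc a) {1..}"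
    if "m \<in> {1..}" for m
    using has_sum_cmult_right[OF harmonic_has_sum[of m], of "1 / real m ^ a"] that
    by (simp add: tornheim_term_def mult_ac)
qed

section \<open>The linear system in weight 7\<close>

lemma double_zeta_4_3: "double_zeta 4 3 = 17 * zeta 7 - 10 * zeta 2 * zeta 5"
proof -
  have s520: "tornheim_summable 5 2 0" and e520z: "tornheim 5 2 0 = zeta 5 * zeta 2"
    by (rule tornheim_0_right; simp)+
  have s430: "tornheim_summable 4 3 0" and e430z: "tornheim 4 3 0 = zeta 4 * zeta 3"
    by (rule tornheim_0_right; simp)+
  \<comment> \<open>Both products are expanded until one of the first two exponents is 0; each
    branch that is expanded further carries its summability.\<close>
  have s421: "tornheim_summable 4 2 1"
    and s511: "tornheim_summable 5 1 1"
    and e520: "tornheim 5 2 0 = tornheim 4 2 1 + tornheim 5 1 1"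
    using tornheim_rec[OF s520] by (simp_all add: numeral_eq_Suc)
  have s412: "tornheim_summable 4 1 2"
    and e511: "tornheim 5 1 1 = tornheim 4 1 2 + tornheim 5 0 2"
    using tornheim_rec[OF s511] by (simp_all add: numeral_eq_Suc)
  have s313: "tornheim_summable 3 1 3"
    and e412: "tornheim 4 1 2 = tornheim 3 1 3 + tornheim 4 0 3"
    using tornheim_rec[OF s412] by (simp_all add: numeral_eq_Suc)
  have s214: "tornheim_summable 2 1 4"
    and e313: "tornheim 3 1 3 = tornheim 2 1 4 + tornheim 3 0 4"
    using tornheim_rec[OF s313] by (simp_all add: numeral_eq_Suc)
  have s115: "tornheim_summable 1 1 5"
    and e214: "tornheim 2 1 4 = tornheim 1 1 5 + tornheim 2 0 5"
    using tornheim_rec[OF s214] by (simp_all add: numeral_eq_Suc)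
  have s322: "tornheim_summable 3 2 2"
    and e421: "tornheim 4 2 1 = tornheim 3 2 2 + tornheim 4 1 2"
    using tornheim_rec[OF s421] by (simp_all add: numeral_eq_Suc)
  have s223: "tornheim_summable 2 2 3"
    and e322: "tornheim 3 2 2 = tornheim 2 2 3 + tornheim 3 1 3"
    using tornheim_rec[OF s322] by (simp_all add: numeral_eq_Suc)
  have s124: "tornheim_summable 1 2 4"
    and e223: "tornheim 2 2 3 = tornheim 1 2 4 + tornheim 2 1 4"
    using tornheim_rec[OF s223] by (simp_all add: numeral_eq_Suc)
  have s016: "tornheim_summable 0 1 6"
    and e115: "tornheim 1 1 5 = tornheim 0 1 6 + tornheim 1 0 6"
    using tornheim_rec[OF s115] by (simp_all add: numeral_eq_Suc)
  have e124: "tornheim 1 2 4 = tornheim 0 2 5 + tornheim 1 1 5"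
    using tornheim_rec[OF s124] by (simp_all add: numeral_eq_Suc)
  have s331: "tornheim_summable 3 3 1"
    and e430: "tornheim 4 3 0 = tornheim 3 3 1 + tornheim 4 2 1"
    using tornheim_rec[OF s430] by (simp_all add: numeral_eq_Suc)
  have e331: "tornheim 3 3 1 = tornheim 2 3 2 + tornheim 3 2 2"
    using tornheim_rec(3)[OF s331] by (simp add: numeral_eq_Suc)
  have "((\<lambda>n. gen_harm n 1 / real n ^ 6) has_sum tornheim 5 1 1) {1..}"
    using tornheim_1_1_has_sum[OF s511] by simp
  \<comment> \<open>The exponent 1 rules out \<open>zeta_mult_stuffle\<close>; summability comes
    from the leaf T(0,1,6) of the recursion.\<close>
  moreover have "double_zeta_summable 6 1"
    using s016 by (rule tornheim_summable_0_left)
  \<comment> \<open>The recursion gives T(5,1,1) as 2 zeta(6,1) + zeta(5,2) + zeta(4,3) + zeta(3,4)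
    + zeta(2,5). Equating the two values is Euler's sum formula in weight 7.\<close>
  ultimately have e511h: "tornheim 5 1 1 = double_zeta 6 1 + zeta 7"
    using gen_harm_div_has_sum[of 6 1] by (auto dest: has_sum_unique)
  note stuffle = zeta_mult_stuffle(2)[of 5 2, simplified] zeta_mult_stuffle(2)[of 4 3, simplified]
  \<comment> \<open>By symmetry T(3,3,1) = 2 T(3,2,2). The products of zeta values are atoms for
    \<open>linarith\<close>, so each needs a single order of factors; zeta(3) zeta(4) cancels in the
    solution.\<close>
  show ?thesis
    using stuffle e520z e430z e511h e520 e511 e412 e313 e214 e421 e322 e223 e115 e124 e430 e331
      tornheim_commute[of 2 3 2]
    unfolding tornheim_0_left tornheim_0_middle
      mult.commute[of "zeta 5" "zeta 2"] mult.commute[of "zeta 4" "zeta 3"]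
    by linarith
qed

section \<open>Summation by parts and evaluation of the series\<close>

theorem mainTheorem5:
  shows "(\<lambda>n. let r = Suc n in (gen_harm r 3)\<^sup>2 / (real r * (real r + 1)))
           sums (- (10 * pi\<^sup>2 / 3) * zeta 5 + 35 * zeta 7)"
proof -
  have zs: "summable (\<lambda>n. 1 / real (Suc n) ^ 3)"
    by (rule summable_zeta) simp
  have "gen_harm (Suc n) 3 = (\<Sum>k<Suc n. 1 / real (Suc k) ^ 3)" for n
    unfolding gen_harm_def by (induction n) auto
  then have lim: "(\<lambda>n. gen_harm (Suc n) 3) \<longlonglongrightarrow> zeta 3"
    using LIMSEQ_Suc[OF summable_LIMSEQ[OF zs]] unfolding zeta_def by simp
  have "(\<lambda>n. 1 / real (Suc n + 1)) \<longlonglongrightarrow> 0"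
    using LIMSEQ_ignore_initial_segment[OF lim_inverse_n', of 2] by (simp add: add_ac)
  \<comment> \<open>The squared harmonic numbers converge, so the factor tending to 0 makes the
    boundary term vanish.\<close>
  from tendsto_mult[OF tendsto_power[OF lim, of 2] this]
  have boundary: "(\<lambda>n. (gen_harm (Suc n) 3)\<^sup>2 / real (Suc n + 1)) \<longlonglongrightarrow> 0"
    by simp
  have "double_zeta_summable 4 3"
    by (rule zeta_mult_stuffle) simp_all
  from has_sum_imp_sums[OF iffD2[OF has_sum_Suc_iff gen_harm_div_has_sum[OF this]]]
  have S: "(\<lambda>n. gen_harm (Suc n) 3 / real (Suc n) ^ 4) sums (double_zeta 4 3 + zeta 7)"
    by simp
  have Z: "(\<lambda>n. 1 / real (Suc n) ^ 7) sums zeta 7"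
    unfolding zeta_def by (intro summable_sums summable_zeta) simp
  \<comment> \<open>Abel summation with 1/(r(r+1)) = 1/r - 1/(r+1): the difference of consecutive
    squares is 2 H_r / r^3 - 1/r^6, here divided by r.\<close>
  have parts: "(\<Sum>k<Suc n. (gen_harm (Suc k) 3)\<^sup>2 / (real (Suc k) * (real (Suc k) + 1)))
        = (\<Sum>k<Suc n. 2 * (gen_harm (Suc k) 3 / real (Suc k) ^ 4) - 1 / real (Suc k) ^ 7)
          - (gen_harm (Suc n) 3)\<^sup>2 / real (Suc n + 1)" for n
  proof (induction n)
    case 0
    show ?case by (simp add: gen_harm_def)
  next
    case (Suc n)
    define h x where "h = gen_harm (Suc n) 3" and "x = real (Suc (Suc n))"
    have x: "x > 0" by (simp add: x_def)
    have *: "gen_harm (Suc (Suc n)) 3 = h + 1 / x ^ 3"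
      unfolding h_def x_def by (rule gen_harm_Suc)
    \<comment> \<open>Here \<open>x\<close> is the new index r and \<open>h\<close> is H_{r-1};
      \<open>h\<^sup>2 / x\<close> is the old boundary term.\<close>
    have "(h + 1 / x ^ 3)\<^sup>2 / (x * (x + 1)) - h\<^sup>2 / x
            = 2 * ((h + 1 / x ^ 3) / x ^ 4) - 1 / x ^ 7 - (h + 1 / x ^ 3)\<^sup>2 / (x + 1)"
      using x by (simp add: divide_simps) (simp add: algebra_simps eval_nat_numeral)
    moreover have "real (Suc n + 1) = x" "real (Suc (Suc n) + 1) = x + 1"
      by (simp_all add: x_def)
    ultimately show ?case
      using Suc.IH unfolding sum.lessThan_Suc[of _ "Suc n"] *
      unfolding h_def[symmetric] x_def[symmetric] by (simp add: algebra_simps)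
  qed
  have "(\<lambda>n. 2 * (gen_harm (Suc n) 3 / real (Suc n) ^ 4) - 1 / real (Suc n) ^ 7)
          sums (2 * (double_zeta 4 3 + zeta 7) - zeta 7)"
    by (intro sums_diff sums_mult S Z)
  \<comment> \<open>\<open>parts\<close> concerns partial sums of length \<open>Suc n\<close>, hence
    the shift, which \<open>LIMSEQ_imp_Suc\<close> undoes.\<close>
  from tendsto_diff[OF LIMSEQ_Suc[OF this[unfolded sums_def]] boundary]
  have "(\<lambda>n. \<Sum>k<Suc n. (gen_harm (Suc k) 3)\<^sup>2 / (real (Suc k) * (real (Suc k) + 1)))
          \<longlonglongrightarrow> 2 * (double_zeta 4 3 + zeta 7) - zeta 7"
    unfolding parts by simp
  then have "(\<lambda>n. (gen_harm (Suc n) 3)\<^sup>2 / (real (Suc n) * (real (Suc n) + 1)))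
          sums (2 * (double_zeta 4 3 + zeta 7) - zeta 7)"
    unfolding sums_def by (rule LIMSEQ_imp_Suc)
  \<comment> \<open>The value is 35 zeta(7) - 20 zeta(2) zeta(5), with zeta(2) = pi^2/6.\<close>
  moreover have "2 * (double_zeta 4 3 + zeta 7) - zeta 7
                   = - (10 * pi\<^sup>2 / 3) * zeta 5 + 35 * zeta 7"
    by (simp add: double_zeta_4_3 zeta_2)
  ultimately show ?thesis by (simp add: Let_def)
qed

end
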